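(* Let $\mathcal{M}$ be a moon polyomino with $n$ rows and $m$ columns, and let $\mathbf{e}\in\{0,1\}^n$ and $\mathbf{s}\in\mathbb{N}^m$ satisfy $\sum_i\varepsilon_i=\sum_j s_j$. For $T\subseteq[m]$ define $$G^l_T(p,q)=\sum_{M\in\mathbf{F}(\mathcal{M},\mathbf{e},\mathbf{s})} p^{\gamma(T;M)}q^{\gamma(\bar T;M)},\qquad G^r_T(p,q)=\sum_{M\in\mathbf{F}(\mathcal{M},\mathbf{e},\mathbf{s})} p^{\delta(T;M)}q^{\delta(\bar T;M)},$$ where $\bar T=[m]\setminus T$. Then $G^l_T(p,q)=G^l_{T'}(p,q)$ for any two subsets $T,T'\subseteq[m]$; consequently $$G^l_T(p,q)=G^l_\emptyset(p,q)=\sum_{M\in\mathbf{F}(\mathcal{M},\mathbf{e},\mathbf{s})}p^{\mathrm{se}(M)}q^{\mathrm{ne}(M)},$$ and this is a symmetric function of $p,q$. The same statements hold for $G^r_T(p,q)$.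
   Context: A polyomino is a finite set of unit square cells in $\mathbb{Z}^2$. It is convex if its intersection with every row and every column is connected, and intersection-free if any two columns are comparable (the set of rows met by one column is contained in the set of rows met by the other). A moon polyomino is a convex, intersection-free polyomino. Label its rows $R_1,\dots,R_n$ from top to bottom and its columns $C_1,\dots,C_m$ from left to right. A filling is an assignment of $0$ or $1$ to each cell such that each row contains at most one $1$; a cell containing $1$ is a $1$-cell. For $\mathbf{e}=(\varepsilon_1,\dots,\varepsilon_n)\in\{0,1\}^n$ and $\mathbf{s}=(s_1,\dots,s_m)\in\mathbb{N}^m$, $\mathbf{F}(\mathcal{M},\mathbf{e},\mathbf{s})$ is the set of fillings in which row $R_i$ contains exactly $\varepsilon_i$ ones and column $C_j$ contains exactly $s_j$ ones. A northeast (NE) chain (resp. southeast (SE) chain) of a filling $M$ is a set of two $1$-cells such that one is strictly above (resp. strictly below) and strictly to the right of the other, and the smallest rectangle containing both is contained in $\mathcal{M}$. $\mathrm{ne}(M)$ and $\mathrm{se}(M)$ denote the numbers of NE and SE chains. For $T\subseteq[m]$, let $\mathcal{C}(T)=\bigcup_{j\in T}C_j$. Define $\gamma(T;M)$ as the number of NE chains whose left $1$-cell lies in $\mathcal{C}(T)$ plus the number of SE chains whose left $1$-cell lies in $\mathcal{C}(\bar T)$; define $\delta(T;M)$ as the number of NE chains whose right $1$-cell lies in $\mathcal{C}(T)$ plus the number of SE chains whose right $1$-cell lies in $\mathcal{C}(\bar T)$. *)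

theory Defs
  imports Complex_Main "HOL-Library.FuncSet"
begin

text \<open>A cell is its pair of integer coordinates \<open>(x, y)\<close>: \<open>x\<close> grows from left to right and \<open>y\<close>
  grows from bottom to top.\<close>

type_synonym cell = "int \<times> int"

definition polyomino :: "cell set \<Rightarrow> bool" where
  "polyomino P \<longleftrightarrow> finite P"

text \<open>A set of cells lying in one row or one column is connected iff it has no gaps.\<close>

definition convex_polyomino :: "cell set \<Rightarrow> bool" where
  "convex_polyomino P \<longleftrightarrow> polyomino P \<and>
     (\<forall>y x1 x2 x. (x1, y) \<in> P \<and> (x2, y) \<in> P \<and> x1 \<le> x \<and> x \<le> x2 \<longrightarrow> (x, y) \<in> P) \<and>
     (\<forall>x y1 y2 y. (x, y1) \<in> P \<and> (x, y2) \<in> P \<and> y1 \<le> y \<and> y \<le> y2 \<longrightarrow> (x, y) \<in> P)"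

definition intersection_free :: "cell set \<Rightarrow> bool" where
  "intersection_free P \<longleftrightarrow>
     (\<forall>x1 x2. {y. (x1, y) \<in> P} \<subseteq> {y. (x2, y) \<in> P} \<or> {y. (x2, y) \<in> P} \<subseteq> {y. (x1, y) \<in> P})"

definition moon_polyomino :: "cell set \<Rightarrow> bool" where
  "moon_polyomino P \<longleftrightarrow> convex_polyomino P \<and> intersection_free P"

definition num_rows :: "cell set \<Rightarrow> nat" where
  "num_rows P = card (snd ` P)"

definition num_cols :: "cell set \<Rightarrow> nat" where
  "num_cols P = card (fst ` P)"

text \<open>The nonempty rows are numbered \<open>1, \<dots>, num_rows P\<close> from top to bottom (by decreasing \<open>y\<close>),
  the nonempty columns \<open>1, \<dots>, num_cols P\<close> from left to right. Only these indices are meaningful.\<close>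

definition row :: "cell set \<Rightarrow> nat \<Rightarrow> cell set" where
  "row P i = {c \<in> P. snd c = rev (sorted_list_of_set (snd ` P)) ! (i - 1)}"

definition col :: "cell set \<Rightarrow> nat \<Rightarrow> cell set" where
  "col P j = {c \<in> P. fst c = sorted_list_of_set (fst ` P) ! (j - 1)}"

definition cols :: "cell set \<Rightarrow> nat set \<Rightarrow> cell set" where
  "cols P T = (\<Union>j\<in>T. col P j)"

definition co_cols :: "cell set \<Rightarrow> nat set \<Rightarrow> nat set" where
  "co_cols P T = {1..num_cols P} - T"

text \<open>Fillings are extensional functions (\<open>undefined\<close> off \<open>P\<close>), so that distinct functions are
  distinct fillings.\<close>

definition ones :: "cell set \<Rightarrow> (cell \<Rightarrow> nat) \<Rightarrow> cell set" where
  "ones P M = {c \<in> P. M c = 1}"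

definition fillings :: "cell set \<Rightarrow> (cell \<Rightarrow> nat) set" where
  "fillings P = {M \<in> P \<rightarrow>\<^sub>E {0, 1}. \<forall>i\<in>{1..num_rows P}. card (ones P M \<inter> row P i) \<le> 1}"

definition fillings_with :: "cell set \<Rightarrow> (nat \<Rightarrow> nat) \<Rightarrow> (nat \<Rightarrow> nat) \<Rightarrow> (cell \<Rightarrow> nat) set" where
  "fillings_with P e s = {M \<in> fillings P.
     (\<forall>i\<in>{1..num_rows P}. card (ones P M \<inter> row P i) = e i) \<and>
     (\<forall>j\<in>{1..num_cols P}. card (ones P M \<inter> col P j) = s j)}"

definition bounding_rectangle :: "cell set \<Rightarrow> cell set" where
  "bounding_rectangle S =
     {Min (fst ` S)..Max (fst ` S)} \<times> {Min (snd ` S)..Max (snd ` S)}"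

definition ne_chains :: "cell set \<Rightarrow> (cell \<Rightarrow> nat) \<Rightarrow> cell set set" where
  "ne_chains P M = {{a, b} | a b. a \<in> ones P M \<and> b \<in> ones P M \<and>
     fst a < fst b \<and> snd a < snd b \<and> bounding_rectangle {a, b} \<subseteq> P}"

definition se_chains :: "cell set \<Rightarrow> (cell \<Rightarrow> nat) \<Rightarrow> cell set set" where
  "se_chains P M = {{a, b} | a b. a \<in> ones P M \<and> b \<in> ones P M \<and>
     fst a < fst b \<and> snd a > snd b \<and> bounding_rectangle {a, b} \<subseteq> P}"

definition ne :: "cell set \<Rightarrow> (cell \<Rightarrow> nat) \<Rightarrow> nat" where
  "ne P M = card (ne_chains P M)"

definition se :: "cell set \<Rightarrow> (cell \<Rightarrow> nat) \<Rightarrow> nat" where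
  "se P M = card (se_chains P M)"

text \<open>The two cells of a chain lie in different columns, so for chains both choices below are
  unique.\<close>

definition left_cell :: "cell set \<Rightarrow> cell" where
  "left_cell S = arg_min fst (\<lambda>c. c \<in> S)"

definition right_cell :: "cell set \<Rightarrow> cell" where
  "right_cell S = arg_max fst (\<lambda>c. c \<in> S)"

definition gamma_stat :: "cell set \<Rightarrow> nat set \<Rightarrow> (cell \<Rightarrow> nat) \<Rightarrow> nat" where
  "gamma_stat P T M =
     card {S \<in> ne_chains P M. left_cell S \<in> cols P T} +
     card {S \<in> se_chains P M. left_cell S \<in> cols P (co_cols P T)}"

definition delta_stat :: "cell set \<Rightarrow> nat set \<Rightarrow> (cell \<Rightarrow> nat) \<Rightarrow> nat" where
  "delta_stat P T M =
     card {S \<in> ne_chains P M. right_cell S \<in> cols P T} +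
     card {S \<in> se_chains P M. right_cell S \<in> cols P (co_cols P T)}"

text \<open>The generating polynomials are evaluated at arbitrary elements of an arbitrary commutative
  semiring; taking \<open>p\<close>, \<open>q\<close> to be the two variables of a polynomial ring gives back the polynomials
  themselves.\<close>

definition G_left ::
    "cell set \<Rightarrow> (nat \<Rightarrow> nat) \<Rightarrow> (nat \<Rightarrow> nat) \<Rightarrow> nat set \<Rightarrow> 'a::comm_semiring_1 \<Rightarrow> 'a \<Rightarrow> 'a" where
  "G_left P e s T p q =
     (\<Sum>M\<in>fillings_with P e s. p ^ gamma_stat P T M * q ^ gamma_stat P (co_cols P T) M)"

definition G_right ::
    "cell set \<Rightarrow> (nat \<Rightarrow> nat) \<Rightarrow> (nat \<Rightarrow> nat) \<Rightarrow> nat set \<Rightarrow> 'a::comm_semiring_1 \<Rightarrow> 'a \<Rightarrow> 'a" where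
  "G_right P e s T p q =
     (\<Sum>M\<in>fillings_with P e s. p ^ delta_stat P T M * q ^ delta_stat P (co_cols P T) M)"

end

theory Submission
  imports Defs
begin

text \<open>Two 1-cells in columns \<open>u\<close> and \<open>v\<close> form a chain iff each of the two rows meets both columns.
  Fix a total order of the columns and let a chain contribute \<open>p\<close> if its lower cell lies in the
  smaller column, and \<open>q\<close> otherwise. All statistics of the theorem arise in this way from suitable
  orders, and reversing the order exchanges \<open>p\<close> and \<open>q\<close>; so it suffices that the generating
  function does not depend on the order. It is invariant under exchanging two columns \<open>x\<close>, \<open>y\<close>
  adjacent in the order: reverse the word in the letters \<open>x\<close>, \<open>y\<close> formed by the 1-cells of these
  columns in their common rows. This turns the chains between \<open>x\<close> and \<open>y\<close> upside down and, since
  the row sets of the columns are nested intervals, preserves the numbers of all other chains of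
  either weight.\<close>

section \<open>Column orders, placements of 1-cells, and the exchange of two columns\<close>

text \<open>A row holds at most one 1-cell, so a chain is recorded by its two rows, the lower one
  first. The values of \<open>f\<close> give the order of the columns, and the two opposite corners
  stand for the whole bounding rectangle.\<close>

definition row_pairs :: "cell set \<Rightarrow> (int \<Rightarrow> int) \<Rightarrow> cell set \<Rightarrow> (int \<times> int) set" where
  "row_pairs P f Q = {(r, r'). r < r' \<and>
     (\<exists>v v'. (v, r) \<in> Q \<and> (v', r') \<in> Q \<and> (v, r') \<in> P \<and> (v', r) \<in> P \<and> f v < f v')}"

definition order_gf :: "cell set \<Rightarrow> cell set set \<Rightarrow> (int \<Rightarrow> int) \<Rightarrow> 'a::comm_semiring_1 \<Rightarrow> 'a \<Rightarrow> 'a" where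
  "order_gf P \<Q> f p q =
     (\<Sum>Q\<in>\<Q>. p ^ card (row_pairs P f Q) * q ^ card (row_pairs P (\<lambda>v. - f v) Q))"

text \<open>These are the sets of 1-cells of fillings; \<open>inj_on snd\<close> allows at most one
  per row.\<close>

definition placements :: "cell set \<Rightarrow> (nat \<Rightarrow> nat) \<Rightarrow> (nat \<Rightarrow> nat) \<Rightarrow> cell set set" where
  "placements P e s = {Q. Q \<subseteq> P \<and> inj_on snd Q \<and>
     (\<forall>i\<in>{1..num_rows P}. card (Q \<inter> row P i) = e i) \<and>
     (\<forall>j\<in>{1..num_cols P}. card (Q \<inter> col P j) = s j)}"

definition order_reversing_on :: "int set \<Rightarrow> (int \<Rightarrow> int) \<Rightarrow> bool" where
  "order_reversing_on B \<tau> \<longleftrightarrow> (\<forall>r\<in>B. \<tau> r \<in> B) \<and> (\<forall>r. \<tau> (\<tau> r) = r) \<and>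
     (\<forall>r\<in>B. \<forall>r'\<in>B. r < r' \<longrightarrow> \<tau> r' < \<tau> r) \<and> (\<forall>r. r \<notin> B \<longrightarrow> \<tau> r = r)"

definition reversal :: "int set \<Rightarrow> int \<Rightarrow> int" where
  "reversal B = (SOME \<tau>. order_reversing_on B \<tau>)"

text \<open>These rows are the positions of the letters of the word in \<open>x\<close> and
  \<open>y\<close>.\<close>

definition shared_rows :: "cell set \<Rightarrow> int \<Rightarrow> int \<Rightarrow> cell set \<Rightarrow> int set" where
  "shared_rows P x y Q = {r. (x, r) \<in> P \<and> (y, r) \<in> P \<and> ((x, r) \<in> Q \<or> (y, r) \<in> Q)}"

text \<open>Cells move along their columns. As the reversal is an involution, the preimage taken
  here is also the image.\<close>

definition exchange :: "cell set \<Rightarrow> int \<Rightarrow> int \<Rightarrow> cell set \<Rightarrow> cell set" where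
  "exchange P x y Q = {(v, r). (v, reversal (shared_rows P x y Q) r) \<in> Q}"

text \<open>For a finite set a reversal exists: send the i-th smallest element to the i-th
  largest.\<close>

lemma reversal:
  assumes "finite B"
  shows reversal_in: "r \<in> B \<Longrightarrow> reversal B r \<in> B"
    and reversal_reversal: "reversal B (reversal B r) = r"
    and reversal_less: "r \<in> B \<Longrightarrow> r' \<in> B \<Longrightarrow> r < r' \<Longrightarrow> reversal B r' < reversal B r"
    and reversal_notin: "r \<notin> B \<Longrightarrow> reversal B r = r"
proof -
  define xs where "xs = sorted_list_of_set B"
  define n where "n = length xs"
  have set_xs: "set xs = B" and srt: "sorted_wrt (<) xs"
    using assms by (auto simp: xs_def)
  have lt: "xs ! i < xs ! j" if "i < j" "j < n" for i j
    using sorted_wrt_nth_less[OF srt] that n_def by blast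
  define k where "k r = (THE i. i < n \<and> xs ! i = r)" for r
  have ex: "\<exists>i<n. xs ! i = r" if "r \<in> B" for r
    using that set_xs n_def by (metis in_set_conv_nth)
  have k_nth: "k (xs ! i) = i" if "i < n" for i
    unfolding k_def using that lt by (intro the_equality) (auto, metis less_irrefl linorder_neqE_nat)
  define \<tau> where "\<tau> r = (if r \<in> B then xs ! (n - 1 - k r) else r)" for r
  have nthB: "xs ! i \<in> B" if "i < n" for i
    using that set_xs n_def nth_mem by blast
  have \<tau>_nth: "\<tau> (xs ! i) = xs ! (n - 1 - i)" if "i < n" for i
    using that by (simp add: \<tau>_def k_nth nthB)
  have "order_reversing_on B \<tau>"
    unfolding order_reversing_on_def
  proof (intro conjI ballI allI impI)
    fix r assume "r \<in> B"
    then obtain i where i: "i < n" "r = xs ! i" using ex by blast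
    then show "\<tau> r \<in> B" by (simp add: \<tau>_nth nthB)
  next
    fix r show "\<tau> (\<tau> r) = r"
    proof (cases "r \<in> B")
      case True
      then obtain i where "i < n" "r = xs ! i" using ex by blast
      then show ?thesis by (simp add: \<tau>_nth)
    qed (simp add: \<tau>_def)
  next
    fix r r' assume "r \<in> B" "r' \<in> B" and less: "r < r'"
    then obtain i j where i: "i < n" "r = xs ! i" and j: "j < n" "r' = xs ! j"
      using ex by metis
    have "i < j" using less i j lt by (metis less_asym linorder_neqE_nat order.irrefl)
    then show "\<tau> r' < \<tau> r" using i j by (simp add: \<tau>_nth lt)
  qed (simp add: \<tau>_def)
  then have *: "order_reversing_on B (reversal B)"
    unfolding reversal_def by (rule someI[of "order_reversing_on B" \<tau>])
  show "r \<in> B \<Longrightarrow> reversal B r \<in> B" "reversal B (reversal B r) = r"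
    "r \<in> B \<Longrightarrow> r' \<in> B \<Longrightarrow> r < r' \<Longrightarrow> reversal B r' < reversal B r"
    "r \<notin> B \<Longrightarrow> reversal B r = r"
    using * unfolding order_reversing_on_def by blast+
qed

section \<open>Geometry of a moon polyomino\<close>

context
  fixes P :: "cell set"
  assumes moon: "moon_polyomino P"
begin

lemma finite_moon: "finite P"
  using moon by (simp add: moon_polyomino_def convex_polyomino_def polyomino_def)

lemma row_convex: "(u, r) \<in> P \<Longrightarrow> (w, r) \<in> P \<Longrightarrow> u \<le> v \<Longrightarrow> v \<le> w \<Longrightarrow> (v, r) \<in> P"
  using moon unfolding moon_polyomino_def convex_polyomino_def by blast

lemma col_convex: "(v, a) \<in> P \<Longrightarrow> (v, c) \<in> P \<Longrightarrow> a \<le> b \<Longrightarrow> b \<le> c \<Longrightarrow> (v, b) \<in> P"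
  using moon unfolding moon_polyomino_def convex_polyomino_def by blast

text \<open>The row \<open>r'\<close> prevents column \<open>v\<close> from being contained in
  column \<open>u\<close>, so \<open>u\<close> is contained in \<open>v\<close>.\<close>

lemma col_comparable:
  "(u, r) \<in> P \<Longrightarrow> (u, r') \<notin> P \<Longrightarrow> (v, r') \<in> P \<Longrightarrow> (v, r) \<in> P"
  using moon unfolding moon_polyomino_def intersection_free_def by blast

lemma finite_shared_rows: "finite (shared_rows P x y Q)"
  by (rule finite_subset[of _ "snd ` P"]) (force simp: shared_rows_def finite_moon)+

lemma finite_row_pairs: "Q \<subseteq> P \<Longrightarrow> finite (row_pairs P f Q)"
  by (rule finite_subset[of _ "snd ` P \<times> snd ` P"])
    (force simp: row_pairs_def finite_moon)+

lemmas rev = reversal[OF finite_shared_rows]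

lemma row_unique: "inj_on snd Q \<Longrightarrow> (u, r) \<in> Q \<Longrightarrow> (v, r) \<in> Q \<Longrightarrow> u = v"
  using inj_onD[of snd Q "(u, r)" "(v, r)"] by simp

section \<open>The exchange as an involution on placements\<close>

text \<open>The reversal permutes the shared rows and fixes all others. Hence the second exchange
  uses the same reversal as the first and undoes it.\<close>

lemma shared_rows_exchange:
  assumes "inj_on snd Q"
  shows "shared_rows P x y (exchange P x y Q) = shared_rows P x y Q"
proof -
  let ?B = "shared_rows P x y Q"
  have "r \<in> shared_rows P x y (exchange P x y Q) \<longleftrightarrow> r \<in> ?B" for r
  proof (cases "r \<in> ?B")
    case True
    then have "reversal ?B r \<in> ?B" by (rule rev)
    with True show ?thesis by (auto simp: shared_rows_def exchange_def)
  next
    case False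
    then have "reversal ?B r = r" by (rule rev)
    with False show ?thesis by (simp add: shared_rows_def exchange_def)
  qed
  then show ?thesis by blast
qed

lemma exchange_exchange:
  assumes "inj_on snd Q"
  shows "exchange P x y (exchange P x y Q) = Q"
proof -
  have "exchange P x y (exchange P x y Q) =
      {(v, r). (v, reversal (shared_rows P x y Q) r) \<in> exchange P x y Q}"
    by (simp add: exchange_def[of P x y "exchange P x y Q"] shared_rows_exchange[OF assms])
  also have "\<dots> = Q" by (auto simp: exchange_def rev)
  finally show ?thesis .
qed

lemma exchange_subset:
  assumes "Q \<subseteq> P" "inj_on snd Q"
  shows "exchange P x y Q \<subseteq> P"
proof
  fix c assume c: "c \<in> exchange P x y Q"
  obtain v r where vr: "c = (v, r)" by fastforce
  let ?B = "shared_rows P x y Q"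
  have v: "(v, reversal ?B r) \<in> Q" using c vr by (simp add: exchange_def)
  show "c \<in> P"
  proof (cases "r \<in> ?B")
    case True
    then have "reversal ?B r \<in> ?B" by (rule rev)
    \<comment> \<open>A shared row has its only 1-cell in column \<open>x\<close> or
      \<open>y\<close>, and both columns contain row \<open>r\<close>.\<close>
    with v have "v = x \<or> v = y"
      using row_unique[OF assms(2)] by (auto simp: shared_rows_def)
    with True vr show ?thesis by (auto simp: shared_rows_def)
  next
    case False
    then have "reversal ?B r = r" by (rule rev)
    with v vr assms show ?thesis by auto
  qed
qed

lemma inj_on_snd_exchange:
  assumes "inj_on snd Q"
  shows "inj_on snd (exchange P x y Q)"
  using row_unique[OF assms] by (auto simp: inj_on_def exchange_def)

lemma card_inter_row:
  assumes "inj_on snd Q"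
  shows "card (Q \<inter> row P i) = (if Q \<inter> row P i = {} then 0 else 1)"
proof (cases "Q \<inter> row P i = {}")
  case False
  then obtain c where c: "c \<in> Q \<inter> row P i" by blast
  have "Q \<inter> row P i = {c}"
    using c assms by (auto simp: row_def inj_on_def)
  then show ?thesis by simp
qed simp

text \<open>Occupied rows are permuted among themselves. One direction suffices, since the exchange
  is an involution.\<close>

lemma exchange_meets_row:
  assumes "Q \<subseteq> P" "inj_on snd Q" "exchange P x y Q \<inter> row P i \<noteq> {}"
  shows "Q \<inter> row P i \<noteq> {}"
proof -
  let ?B = "shared_rows P x y Q"
  obtain v r where vr: "(v, r) \<in> exchange P x y Q" "(v, r) \<in> row P i"
    using assms(3) by fastforce
  then have v: "(v, reversal ?B r) \<in> Q" by (simp add: exchange_def)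
  have "\<exists>u. (u, r) \<in> Q"
  proof (cases "r \<in> ?B")
    case True
    then show ?thesis by (auto simp: shared_rows_def)
  next
    case False
    then have "reversal ?B r = r" by (rule rev)
    with v show ?thesis by auto
  qed
  with vr(2) assms(1) show ?thesis by (auto simp: row_def)
qed

text \<open>Column sums survive because cells stay in their columns, row sums because the same rows
  are occupied.\<close>

lemma exchange_placements:
  assumes Q: "Q \<in> placements P e s"
  shows "exchange P x y Q \<in> placements P e s"
proof -
  let ?Q' = "exchange P x y Q"
  let ?t = "apsnd (reversal (shared_rows P x y Q)) :: cell \<Rightarrow> cell"
  have QP: "Q \<subseteq> P" and inj: "inj_on snd Q" using Q by (auto simp: placements_def)
  note Q'P = exchange_subset[OF QP inj, of x y] and inj' = inj_on_snd_exchange[OF inj, of x y]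
  have "?Q' \<inter> row P i = {} \<longleftrightarrow> Q \<inter> row P i = {}" for i
    using exchange_meets_row[OF QP inj, of x y i] exchange_meets_row[OF Q'P inj', of x y i]
    by (auto simp: exchange_exchange[OF inj])
  then have rows: "card (?Q' \<inter> row P i) = card (Q \<inter> row P i)" for i
    by (simp add: card_inter_row inj inj')
  have tt: "?t (?t c) = c" for c by (cases c) (simp add: rev)
  have mem: "c \<in> ?Q' \<longleftrightarrow> ?t c \<in> Q" for c by (cases c) (simp add: exchange_def)
  have cols: "card (?Q' \<inter> col P j) = card (Q \<inter> col P j)" for j
  proof (rule bij_betw_same_card)
    show "bij_betw ?t (?Q' \<inter> col P j) (Q \<inter> col P j)"
      using QP Q'P mem tt
      by (intro bij_betwI[where g = ?t]) (auto simp: col_def)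
  qed
  show ?thesis
    using Q Q'P inj' by (auto simp: placements_def rows cols)
qed

section \<open>Effect of the exchange on the numbers of chains\<close>

text \<open>A 1-cell outside the rows common to the columns \<open>x\<close> and \<open>y\<close> keeps its chains when the
  other cell is moved along its column by the reversal; a 1-cell of a third column inside these
  rows keeps its chains with a fixed row, whichever of \<open>x\<close>, \<open>y\<close> now occupies it.\<close>

lemma card_row_pairs_exchange_le:
  assumes QP: "Q \<subseteq> P" and inj: "inj_on snd Q" and xy: "x \<noteq> y"
    and adj: "\<And>z. z \<in> fst ` P \<Longrightarrow> z \<noteq> x \<Longrightarrow> z \<noteq> y \<Longrightarrow>
       (f z < f x \<longleftrightarrow> f z < f y) \<and> (f x < f z \<longleftrightarrow> f y < f z)"
  shows "card (row_pairs P (f(x := f y, y := f x)) (exchange P x y Q)) \<le> card (row_pairs P f Q)"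
proof -
  define B where "B = shared_rows P x y Q"
  define \<tau> where "\<tau> = reversal B"
  define A where "A = {r. (x, r) \<in> P \<and> (y, r) \<in> P}"
  let ?f = "f(x := f y, y := f x)"
  \<comment> \<open>\<open>g\<close> matches the pairs after the exchange with pairs before it. A
    pair inside \<open>B\<close> is turned upside down; a row of \<open>B\<close> paired with a row
    outside \<open>A\<close> is moved by \<open>\<tau>\<close>; all other pairs stay.\<close>
  define g where "g = (\<lambda>(r, r').
      if r \<in> B \<and> r' \<in> B then (\<tau> r', \<tau> r)
      else if r \<in> B \<and> r' \<notin> A then (\<tau> r, r')
      else if r \<notin> A \<and> r' \<in> B then (r, \<tau> r')
      else (r, r'))"
  have BA: "B \<subseteq> A" by (auto simp: B_def A_def shared_rows_def)
  have \<tau>B: "\<tau> r \<in> B" if "r \<in> B" for r using that rev by (simp add: \<tau>_def B_def)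
  have \<tau>\<tau>: "\<tau> (\<tau> r) = r" for r using rev by (simp add: \<tau>_def B_def)
  have \<tau>less: "\<tau> r' < \<tau> r" if "r \<in> B" "r' \<in> B" "r < r'" for r r'
    using that rev by (simp add: \<tau>_def B_def)
  have \<tau>id: "\<tau> r = r" if "r \<notin> B" for r using that rev by (simp add: \<tau>_def B_def)
  have gg: "g (g z) = z" for z
    using \<tau>B \<tau>\<tau> BA by (cases z) (auto simp: g_def)
  have colB: "v = x \<or> v = y" if "(v, r) \<in> Q" "r \<in> B" for v r
    using that row_unique[OF inj] by (auto simp: B_def shared_rows_def)
  have outB: "v \<noteq> x \<and> v \<noteq> y" if "(v, r) \<in> Q" "r \<in> A" "r \<notin> B" for v r
    using that by (auto simp: B_def A_def shared_rows_def)
  have inB: "\<exists>u. (u, r) \<in> Q \<and> (u = x \<or> u = y)" if "r \<in> B" for r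
    using that by (auto simp: B_def shared_rows_def)
  have AP: "(v, r) \<in> P" if "r \<in> A" "v = x \<or> v = y" for v r
    using that by (auto simp: A_def)
  \<comment> \<open>\<open>A\<close> is an intersection of two intervals, so moving a row within
    \<open>A\<close> never passes a row outside \<open>A\<close>.\<close>
  have inter: "r' < c \<longleftrightarrow> r < c" if "r \<in> A" "r' \<in> A" "c \<notin> A" for r r' c
  proof (rule ccontr)
    assume "\<not> ?thesis"
    then have "(r' < c \<and> c \<le> r) \<or> (r < c \<and> c \<le> r')" by auto
    then have "c \<in> A" using that col_convex[of x r r' c] col_convex[of x r' r c]
        col_convex[of y r r' c] col_convex[of y r' r c] by (auto simp: A_def)
    with that show False by simp
  qed
  \<comment> \<open>Row \<open>c\<close> is missing from column \<open>x\<close> or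
    \<open>y\<close>; by comparability column \<open>z\<close> contains that column, hence all of
    \<open>A\<close>.\<close>
  have super: "(z, r) \<in> P" if "(z, c) \<in> P" "c \<notin> A" "r \<in> A" for z c r
    using that col_comparable[of x r c z] col_comparable[of y r c z] by (auto simp: A_def)
  \<comment> \<open>A third column compares alike with \<open>x\<close> and \<open>y\<close>, so
    these two may be interchanged in any comparison in which at most one side is one of
    them.\<close>
  have cmp: "?f u < ?f v \<longleftrightarrow> f u' < f v'"
    if "u = u' \<or> (u \<in> {x, y} \<and> u' \<in> {x, y})" "v = v' \<or> (v \<in> {x, y} \<and> v' \<in> {x, y})"
      "u \<in> fst ` P" "v \<in> fst ` P" "\<not> (u \<in> {x, y} \<and> v \<in> {x, y})" for u v u' v'
    using that adj[of u] adj[of v] by auto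
  have "g z \<in> row_pairs P f Q" if z: "z \<in> row_pairs P ?f (exchange P x y Q)" for z
  proof -
    obtain r r' v v' where zr: "z = (r, r')" and less: "r < r'"
      and v: "(v, \<tau> r) \<in> Q" and v': "(v', \<tau> r') \<in> Q" and vr': "(v, r') \<in> P"
      and v'r: "(v', r) \<in> P" and fl: "?f v < ?f v'"
      using z unfolding row_pairs_def exchange_def \<tau>_def B_def by blast
    have cP: "v \<in> fst ` P" "v' \<in> fst ` P" using vr' v'r by force+
    show ?thesis
    proof (cases "r \<in> B"; cases "r' \<in> B")
      assume r: "r \<in> B" and r': "r' \<in> B"
      \<comment> \<open>Here the two cells occupy both \<open>x\<close> and \<open>y\<close>. The
        swapped order reverses their comparison, and \<open>\<tau>\<close> reverses their
        rows.\<close>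
      have c: "v = x \<or> v = y" "v' = x \<or> v' = y" using colB \<tau>B r r' v v' by blast+
      have "f v' < f v" using fl c xy by (auto split: if_splits)
      moreover have "(v', \<tau> r) \<in> P" "(v, \<tau> r') \<in> P" using c r r' \<tau>B BA AP by blast+
      ultimately show ?thesis using v v' \<tau>less[OF r r' less] r r'
        by (auto simp: zr g_def row_pairs_def)
    next
      assume r: "r \<in> B" and r': "r' \<notin> B"
      have c: "v = x \<or> v = y" using colB \<tau>B r v by blast
      have v'': "(v', r') \<in> Q" using v' \<tau>id r' by simp
      show ?thesis
      proof (cases "r' \<in> A")
        case True
        have c': "v' \<noteq> x \<and> v' \<noteq> y" using outB v'' True r' by blast
        obtain u where u: "(u, r) \<in> Q" "u = x \<or> u = y" using inB r by blast
        have "f u < f v'" using cmp[of v u v' v'] fl c c' u cP by simp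
        then show ?thesis using u True v'' AP v'r less r r'
          by (auto simp: zr g_def row_pairs_def)
      next
        case False
        \<comment> \<open>Only one of \<open>x\<close>, \<open>y\<close> can contain row
          \<open>r'\<close>, and column \<open>v\<close> does; a cell of \<open>x\<close> or
          \<open>y\<close> in this row would thus share its column with the other cell.\<close>
        have c': "\<not> (v' = x \<or> v' = y)"
        proof
          assume "v' = x \<or> v' = y"
          then have "v = v'" using c vr' v'' QP False by (auto simp: A_def)
          with fl show False by simp
        qed
        have "f v < f v'" using cmp[of v v v' v'] fl c c' cP by simp
        moreover have "(v', \<tau> r) \<in> P" using super[of v' r' "\<tau> r"] False v'' QP \<tau>B r BA by blast
        moreover have "\<tau> r < r'" using inter[of r "\<tau> r" r'] less False \<tau>B r BA by blast
        ultimately show ?thesis using v v'' vr' r r' False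
          by (auto simp: zr g_def row_pairs_def)
      qed
    next
      assume r: "r \<notin> B" and r': "r' \<in> B"
      have c': "v' = x \<or> v' = y" using colB \<tau>B r' v' by blast
      have v'': "(v, r) \<in> Q" using v \<tau>id r by simp
      show ?thesis
      proof (cases "r \<in> A")
        case True
        have c: "v \<noteq> x \<and> v \<noteq> y" using outB v'' True r by blast
        obtain u where u: "(u, r') \<in> Q" "u = x \<or> u = y" using inB r' by blast
        have "f v < f u" using cmp[of v v v' u] fl c c' u cP by simp
        then show ?thesis using u True v'' AP vr' less r r'
          by (auto simp: zr g_def row_pairs_def)
      next
        case False
        have c: "\<not> (v = x \<or> v = y)"
        proof
          assume "v = x \<or> v = y"
          then have "v = v'" using c' v'r v'' QP False by (auto simp: A_def)
          with fl show False by simp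
        qed
        have "f v < f v'" using cmp[of v v v' v'] fl c c' cP by simp
        moreover have "(v, \<tau> r') \<in> P" using super[of v r "\<tau> r'"] False v'' QP \<tau>B r' BA by blast
        moreover have "r < \<tau> r'"
        proof -
          have "\<not> \<tau> r' < r" using inter[of r' "\<tau> r'" r] less False \<tau>B r' BA by auto
          moreover have "\<tau> r' \<noteq> r" using False \<tau>B r' BA by blast
          ultimately show ?thesis by simp
        qed
        ultimately show ?thesis using v' v'' v'r r r' False
          by (auto simp: zr g_def row_pairs_def)
      qed
    next
      assume r: "r \<notin> B" and r': "r' \<notin> B"
      have q: "(v, r) \<in> Q" "(v', r') \<in> Q" using v v' \<tau>id r r' by simp_all
      \<comment> \<open>Cells in both \<open>x\<close> and \<open>y\<close> whose corners lie in
        \<open>P\<close> would put row \<open>r\<close> into \<open>A\<close>, and then into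
        \<open>B\<close>.\<close>
      have n: "\<not> (v \<in> {x, y} \<and> v' \<in> {x, y})"
      proof
        assume c: "v \<in> {x, y} \<and> v' \<in> {x, y}"
        have "v \<noteq> v'" using fl by auto
        then have "r \<in> A" using c q vr' v'r QP by (auto simp: A_def)
        with outB q r c show False by blast
      qed
      have "f v < f v'" using cmp[of v v v' v'] fl n cP by simp
      then show ?thesis using q vr' v'r less r r' by (auto simp: zr g_def row_pairs_def)
    qed
  qed
  \<comment> \<open>As an involution, \<open>g\<close> is injective.\<close>
  then show ?thesis
    by (intro card_inj_on_le[where f = g] finite_row_pairs[OF QP])
      (auto intro!: inj_on_inverseI[where g = g] gg)
qed

text \<open>The reverse inequality is the previous one for the exchanged placement and the swapped
  order, since both operations are involutions.\<close>

lemma card_row_pairs_exchange: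
  assumes QP: "Q \<subseteq> P" and inj: "inj_on snd Q" and xy: "x \<noteq> y"
    and adj: "\<And>z. z \<in> fst ` P \<Longrightarrow> z \<noteq> x \<Longrightarrow> z \<noteq> y \<Longrightarrow>
       (f z < f x \<longleftrightarrow> f z < f y) \<and> (f x < f z \<longleftrightarrow> f y < f z)"
  shows "card (row_pairs P (f(x := f y, y := f x)) (exchange P x y Q)) = card (row_pairs P f Q)"
proof (rule antisym)
  let ?f = "f(x := f y, y := f x)"
  show "card (row_pairs P ?f (exchange P x y Q)) \<le> card (row_pairs P f Q)"
    by (rule card_row_pairs_exchange_le[OF QP inj xy adj])
  have "card (row_pairs P (?f(x := ?f y, y := ?f x)) (exchange P x y (exchange P x y Q)))
      \<le> card (row_pairs P ?f (exchange P x y Q))"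
    using exchange_subset[OF QP inj] inj_on_snd_exchange[OF inj] xy
    by (rule card_row_pairs_exchange_le) (use adj in auto)
  moreover have "?f(x := ?f y, y := ?f x) = f" using xy by auto
  ultimately show "card (row_pairs P f Q) \<le> card (row_pairs P ?f (exchange P x y Q))"
    by (simp add: exchange_exchange[OF inj])
qed

section \<open>Independence of the order of the columns\<close>

lemma order_gf_swap:
  assumes xy: "x \<noteq> y"
    and adj: "\<And>z. z \<in> fst ` P \<Longrightarrow> z \<noteq> x \<Longrightarrow> z \<noteq> y \<Longrightarrow>
       (f z < f x \<longleftrightarrow> f z < f y) \<and> (f x < f z \<longleftrightarrow> f y < f z)"
  shows "order_gf P (placements P e s) (f(x := f y, y := f x)) p q =
    order_gf P (placements P e s) f p q"
  unfolding order_gf_def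
proof (rule sum.reindex_bij_witness[where i = "exchange P x y" and j = "exchange P x y"])
  fix Q assume Q: "Q \<in> placements P e s"
  then have QP: "Q \<subseteq> P" and inj: "inj_on snd Q" by (auto simp: placements_def)
  show "exchange P x y (exchange P x y Q) = Q" by (rule exchange_exchange[OF inj])
  then show "exchange P x y (exchange P x y Q) = Q" .
  show "exchange P x y Q \<in> placements P e s" by (rule exchange_placements[OF Q])
  then show "exchange P x y Q \<in> placements P e s" .
  let ?f = "f(x := f y, y := f x)" and ?Q = "exchange P x y Q"
  have Q'P: "?Q \<subseteq> P" and inj': "inj_on snd ?Q"
    using exchange_subset[OF QP inj] inj_on_snd_exchange[OF inj] .
  have 1: "card (row_pairs P ?f Q) = card (row_pairs P f ?Q)"
    using card_row_pairs_exchange[OF Q'P inj' xy adj] exchange_exchange[OF inj] by simp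
  \<comment> \<open>The columns \<open>x\<close>, \<open>y\<close> are also adjacent in the reversed
    order, and swapping commutes with negation; this handles the exponent of
    \<open>q\<close>.\<close>
  have "card (row_pairs P ((\<lambda>v. - f v)(x := - f y, y := - f x)) (exchange P x y ?Q)) =
      card (row_pairs P (\<lambda>v. - f v) ?Q)"
    by (rule card_row_pairs_exchange[OF Q'P inj' xy, where f = "\<lambda>v. - f v", simplified])
      (use adj in auto)
  moreover have "(\<lambda>v. - f v)(x := - f y, y := - f x) = (\<lambda>v. - ?f v)" by auto
  ultimately have 2: "card (row_pairs P (\<lambda>v. - ?f v) Q) = card (row_pairs P (\<lambda>v. - f v) ?Q)"
    using exchange_exchange[OF inj] by simp
  show "p ^ card (row_pairs P f ?Q) * q ^ card (row_pairs P (\<lambda>v. - f v) ?Q) =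
      p ^ card (row_pairs P ?f Q) * q ^ card (row_pairs P (\<lambda>v. - ?f v) Q)"
    by (simp only: 1 2)
qed

lemma row_pairs_cong:
  assumes "\<And>u v. u \<in> fst ` P \<Longrightarrow> v \<in> fst ` P \<Longrightarrow> f u < f v \<longleftrightarrow> g u < g v"
  shows "row_pairs P f Q = row_pairs P g Q"
proof -
  have "f u < f v \<longleftrightarrow> g u < g v" if "(u, r) \<in> P" "(v, r') \<in> P" for u v r r'
    using that by (intro assms) force+
  then show ?thesis unfolding row_pairs_def by blast
qed

text \<open>This is sorting by adjacent transpositions, with induction on the number of inversions
  of \<open>f\<close> relative to \<open>g\<close>.\<close>

lemma order_gf_independent:
  assumes "inj_on f (fst ` P)" "inj_on g (fst ` P)"
  shows "order_gf P (placements P e s) f p q = order_gf P (placements P e s) g p q"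
proof -
  define D where "D f = {(x, y). x \<in> fst ` P \<and> y \<in> fst ` P \<and> f x < f y \<and> g y < g x}"
    for f :: "int \<Rightarrow> int"
  have finD: "finite (D f)" for f
    by (rule finite_subset[of _ "fst ` P \<times> fst ` P"]) (auto simp: D_def finite_moon)
  from assms(1) show ?thesis
  proof (induction "card (D f)" arbitrary: f rule: less_induct)
    case less
    show ?case
    proof (cases "D f = {}")
      case True
      have "f u < f v \<longleftrightarrow> g u < g v" if "u \<in> fst ` P" "v \<in> fst ` P" for u v
        using that True less.prems assms(2) unfolding D_def inj_on_def
        by (smt (verit) case_prodI empty_iff mem_Collect_eq)
      then have "row_pairs P f Q = row_pairs P g Q"
        "row_pairs P (\<lambda>v. - f v) Q = row_pairs P (\<lambda>v. - g v) Q" for Q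
        by (intro row_pairs_cong; simp)+
      then show ?thesis by (simp add: order_gf_def)
    next
      case False
      \<comment> \<open>An inversion with the least difference of \<open>f\<close>-values is
        adjacent in the order of \<open>f\<close>.\<close>
      obtain z where z: "z \<in> D f" "\<And>w. w \<in> D f \<Longrightarrow> f (snd z) - f (fst z) \<le> f (snd w) - f (fst w)"
        using ex_min_if_finite[OF finite_imageI[OF finD], of "\<lambda>w. f (snd w) - f (fst w)" f] False
        by (force simp: not_less)
      obtain x y where xy: "z = (x, y)" by fastforce
      have D: "x \<in> fst ` P" "y \<in> fst ` P" "f x < f y" "g y < g x"
        using z xy by (auto simp: D_def)
      have nb: "f z < f x \<or> f y < f z" if "z \<in> fst ` P" "z \<noteq> x" "z \<noteq> y" for z
      proof (rule ccontr)
        assume "\<not> ?thesis"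
        moreover have "f z \<noteq> f x" "f z \<noteq> f y"
          using less.prems D that by (auto dest: inj_onD)
        ultimately have b: "f x < f z" "f z < f y" by auto
        \<comment> \<open>If \<open>g z < g x\<close>, the first pair is an inversion; otherwise
          \<open>g y < g z\<close> and the second one is. Either has a smaller difference than
          \<open>(x, y)\<close>.\<close>
        then have "(x, z) \<in> D f \<or> (z, y) \<in> D f" using D that by (auto simp: D_def)
        then show False using z(2)[of "(x, z)"] z(2)[of "(z, y)"] b xy by auto
      qed
      let ?f = "f(x := f y, y := f x)"
      have ne: "x \<noteq> y" using D by auto
      have adj: "(f z < f x \<longleftrightarrow> f z < f y) \<and> (f x < f z \<longleftrightarrow> f y < f z)"
        if "z \<in> fst ` P" "z \<noteq> x" "z \<noteq> y" for z
        using nb[OF that] D by linarith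
      have "D ?f \<subseteq> D f - {(x, y)}"
        using D adj ne by (auto simp: D_def split: if_splits)
      then have "card (D ?f) < card (D f)"
        using z(1) xy finD by (intro psubset_card_mono) auto
      moreover have "inj_on ?f (fst ` P)"
        using less.prems D unfolding inj_on_def by (smt (verit) fun_upd_apply)
      ultimately have "order_gf P (placements P e s) ?f p q = order_gf P (placements P e s) g p q"
        by (rule less.hyps)
      then show ?thesis using order_gf_swap[of x y f e s p q, OF ne adj] by simp
    qed
  qed
qed

section \<open>Numbered rows and columns; fillings as placements\<close>

text \<open>Rows and columns are numbered from 1, list positions from 0.\<close>

lemma bij_betw_nth_pred:
  assumes "distinct xs"
  shows "bij_betw (\<lambda>i. xs ! (i - 1)) {1..length xs} (set xs)"
proof -
  have "bij_betw (\<lambda>i. i - 1) {1..length xs} {..<length xs}"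
    by (rule bij_betwI[where g = Suc]) auto
  from bij_betw_trans[OF this bij_betw_nth[OF assms refl refl]] show ?thesis
    by (simp add: comp_def)
qed

lemma bij_betw_ex1:
  assumes "bij_betw f A B" "b \<in> B"
  shows "\<exists>!a. a \<in> A \<and> f a = b"
proof -
  obtain a where "a \<in> A" "f a = b" using assms by (auto simp: bij_betw_def)
  moreover have "a' = a" if "a' \<in> A" "f a' = b" for a'
    using that calculation assms(1) by (auto simp: bij_betw_def dest: inj_onD)
  ultimately show ?thesis by blast
qed

lemma ex_row: "c \<in> P \<Longrightarrow> \<exists>i\<in>{1..num_rows P}. c \<in> row P i"
  using bij_betw_imp_surj_on[OF bij_betw_nth_pred[of "rev (sorted_list_of_set (snd ` P))"]]
  by (force simp: row_def num_rows_def finite_moon)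

lemma ex1_col: "c \<in> P \<Longrightarrow> \<exists>!j. j \<in> {1..num_cols P} \<and> c \<in> col P j"
proof -
  assume c: "c \<in> P"
  have "bij_betw (\<lambda>i. sorted_list_of_set (fst ` P) ! (i - 1)) {1..num_cols P} (fst ` P)"
    using bij_betw_nth_pred[of "sorted_list_of_set (fst ` P)"]
    by (simp add: num_cols_def finite_moon)
  from bij_betw_ex1[OF this, of "fst c"]
  have "\<exists>!j. j \<in> {1..num_cols P} \<and> sorted_list_of_set (fst ` P) ! (j - 1) = fst c"
    using c by blast
  moreover have "c \<in> col P j \<longleftrightarrow> sorted_list_of_set (fst ` P) ! (j - 1) = fst c" for j
    using c by (auto simp: col_def)
  ultimately show ?thesis by presburger
qed

lemma cols_co_cols:
  assumes "c \<in> P" "T \<subseteq> {1..num_cols P}"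
  shows "c \<in> cols P (co_cols P T) \<longleftrightarrow> c \<notin> cols P T"
  using ex1_col[OF assms(1)] assms(2) unfolding cols_def co_cols_def by blast

text \<open>This allows \<open>T\<close> to be replaced by a set of abscissae.\<close>

lemma cols_iff_column:
  assumes "c \<in> P"
  shows "c \<in> cols P T \<longleftrightarrow> fst c \<in> fst ` cols P T"
proof
  assume "fst c \<in> fst ` cols P T"
  then obtain d where "d \<in> cols P T" "fst c = fst d" by blast
  with assms show "c \<in> cols P T" by (auto simp: cols_def col_def)
qed simp

lemma bij_betw_ones: "bij_betw (ones P) (fillings_with P e s) (placements P e s)"
proof (rule bij_betwI[where g = "\<lambda>Q. \<lambda>c\<in>P. if c \<in> Q then 1 else 0"])
  have "inj_on snd (ones P M)" if M: "M \<in> fillings P" for M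
  proof (rule inj_onI)
    fix a b assume ab: "a \<in> ones P M" "b \<in> ones P M" "snd a = snd b"
    then have "a \<in> P" "b \<in> P" by (auto simp: ones_def)
    then obtain i where i: "i \<in> {1..num_rows P}" "a \<in> row P i" using ex_row by blast
    then have "{a, b} \<subseteq> ones P M \<inter> row P i" using ab \<open>b \<in> P\<close> by (auto simp: row_def)
    moreover have "finite (ones P M \<inter> row P i)"
      by (rule finite_subset[OF _ finite_moon]) (auto simp: ones_def)
    moreover have "card (ones P M \<inter> row P i) \<le> 1" using M i by (auto simp: fillings_def)
    ultimately show "a = b"
      by (metis card_le_Suc0_iff_eq One_nat_def insert_subset)
  qed
  then show "ones P \<in> fillings_with P e s \<rightarrow> placements P e s"
    by (auto simp: fillings_with_def placements_def ones_def)
  have ones_ind: "ones P (\<lambda>c\<in>P. if c \<in> Q then 1 else 0) = Q" if "Q \<subseteq> P" for Q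
    using that by (auto simp: ones_def)
  show "(\<lambda>Q. \<lambda>c\<in>P. if c \<in> Q then 1 else 0) \<in> placements P e s \<rightarrow> fillings_with P e s"
  proof
    fix Q assume Q: "Q \<in> placements P e s"
    \<comment> \<open>The bound on the row sums of a filling comes from the injectivity of
      \<open>snd\<close> on the placement.\<close>
    then have "e i \<le> 1" if "i \<in> {1..num_rows P}" for i
      using that card_inter_row[of Q i] by (auto simp: placements_def split: if_splits)
    with Q show "(\<lambda>c\<in>P. if c \<in> Q then 1 else 0) \<in> fillings_with P e s"
      by (auto simp: placements_def fillings_with_def fillings_def ones_ind
          simp del: restrict_apply)
  qed
  show "ones P (\<lambda>c\<in>P. if c \<in> Q then 1 else 0) = Q" if "Q \<in> placements P e s" for Q
    using that by (intro ones_ind) (simp add: placements_def)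
  show "(\<lambda>c\<in>P. if c \<in> ones P M then 1 else 0) = M" if "M \<in> fillings_with P e s" for M
  proof -
    have "M \<in> P \<rightarrow>\<^sub>E {0, 1}" using that by (simp add: fillings_with_def fillings_def)
    then show ?thesis by (force simp: ones_def fun_eq_iff PiE_iff extensional_def)
  qed
qed

section \<open>Chains as pairs of rows\<close>

text \<open>Column convexity fills the two vertical sides, then row convexity fills the rows between
  them.\<close>

lemma bounding_rectangle_subset_iff:
  assumes "a \<in> P" "b \<in> P"
  shows "bounding_rectangle {a, b} \<subseteq> P \<longleftrightarrow> (fst a, snd b) \<in> P \<and> (fst b, snd a) \<in> P"
proof
  assume "bounding_rectangle {a, b} \<subseteq> P"
  then show "(fst a, snd b) \<in> P \<and> (fst b, snd a) \<in> P"
    by (auto simp: bounding_rectangle_def)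
next
  assume c: "(fst a, snd b) \<in> P \<and> (fst b, snd a) \<in> P"
  show "bounding_rectangle {a, b} \<subseteq> P"
  proof
    fix z assume z: "z \<in> bounding_rectangle {a, b}"
    obtain x y where xy: "z = (x, y)" by fastforce
    have h: "(v, y) \<in> P" if "v = fst a \<or> v = fst b" for v
      using that z c assms col_convex[of v "snd a" "snd b" y] col_convex[of v "snd b" "snd a" y]
      by (auto simp: xy bounding_rectangle_def min_def max_def split: if_splits)
    show "z \<in> P"
      using h[of "fst a"] h[of "fst b"] z row_convex[of "fst a" y "fst b" x]
        row_convex[of "fst b" y "fst a" x]
      by (auto simp: xy bounding_rectangle_def min_def max_def split: if_splits)
  qed
qed

text \<open>The left cell is the lower one in an NE chain and the upper one in an SE chain. So
  \<open>L\<close> and \<open>R\<close> both select the chains whose lower cell lies in the smaller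
  column; suitable choices of them give every statistic of the theorem.\<close>

lemma card_chains_eq_row_pairs:
  assumes inj: "inj_on snd (ones P M)"
    and L: "\<And>a b. a \<in> P \<Longrightarrow> b \<in> P \<Longrightarrow> fst a < fst b \<Longrightarrow> L {a, b} \<longleftrightarrow> f (fst a) < f (fst b)"
    and R: "\<And>a b. a \<in> P \<Longrightarrow> b \<in> P \<Longrightarrow> fst a < fst b \<Longrightarrow> R {a, b} \<longleftrightarrow> f (fst b) < f (fst a)"
  shows "card {S \<in> ne_chains P M. L S} + card {S \<in> se_chains P M. R S} =
    card (row_pairs P f (ones P M))"
proof -
  define Q where "Q = ones P M"
  have QP: "Q \<subseteq> P" by (auto simp: Q_def ones_def)
  \<comment> \<open>Ordered pairs of lower and upper cell mediate between chains, which are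
    unordered, and pairs of rows.\<close>
  define C where "C = {(a, b). a \<in> Q \<and> b \<in> Q \<and> snd a < snd b \<and> (fst a, snd b) \<in> P \<and>
    (fst b, snd a) \<in> P \<and> f (fst a) < f (fst b)}"
  let ?N = "{S \<in> ne_chains P M. L S}" and ?S = "{S \<in> se_chains P M. R S}"
  have fin: "finite ?N" "finite ?S"
    by (rule finite_subset[of _ "Pow P"];
        auto simp: ne_chains_def se_chains_def ones_def finite_moon)+
  have disj: "?N \<inter> ?S = {}"
    by (auto simp: ne_chains_def se_chains_def doubleton_eq_iff)
  have br: "bounding_rectangle {a, b} \<subseteq> P \<longleftrightarrow> (fst a, snd b) \<in> P \<and> (fst b, snd a) \<in> P"
    if "a \<in> Q" "b \<in> Q" for a b
    using that QP by (intro bounding_rectangle_subset_iff) auto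
  have L': "L {a, b} \<longleftrightarrow> f (fst a) < f (fst b)" and R': "R {a, b} \<longleftrightarrow> f (fst b) < f (fst a)"
    if "a \<in> Q" "b \<in> Q" "fst a < fst b" for a b
    using that QP L[of a b] R[of a b] by blast+
  have C_iff: "(a, b) \<in> C \<longleftrightarrow> a \<in> Q \<and> b \<in> Q \<and> snd a < snd b \<and> (fst a, snd b) \<in> P \<and>
    (fst b, snd a) \<in> P \<and> f (fst a) < f (fst b)" for a b
    by (simp add: C_def)
  have "?N = {{a, b} | a b. (a, b) \<in> C \<and> fst a < fst b}" (is "_ = ?N'")
  proof (intro equalityI subsetI)
    fix S assume "S \<in> ?N"
    then obtain a b where ab: "S = {a, b}" "a \<in> Q" "b \<in> Q" "fst a < fst b" "snd a < snd b"
        "bounding_rectangle {a, b} \<subseteq> P" "L {a, b}"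
      unfolding ne_chains_def Q_def by blast
    then have "(a, b) \<in> C" by (simp add: C_iff br L')
    with ab show "S \<in> ?N'" by blast
  next
    fix S assume "S \<in> ?N'"
    then obtain a b where ab: "S = {a, b}" "(a, b) \<in> C" "fst a < fst b" by blast
    then have "bounding_rectangle {a, b} \<subseteq> P" "L {a, b}" by (simp_all add: C_iff br L')
    with ab show "S \<in> ?N" unfolding ne_chains_def C_iff Q_def by blast
  qed
  moreover have "?S = {{a, b} | a b. (a, b) \<in> C \<and> fst b < fst a}" (is "_ = ?S'")
  proof (intro equalityI subsetI)
    fix S assume "S \<in> ?S"
    then obtain a b where ab: "S = {b, a}" "a \<in> Q" "b \<in> Q" "fst a < fst b" "snd a > snd b"
        "bounding_rectangle {a, b} \<subseteq> P" "R {a, b}"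
      unfolding se_chains_def Q_def by blast
    then have "(b, a) \<in> C" by (simp add: C_iff br R')
    with ab show "S \<in> ?S'" by blast
  next
    fix S assume "S \<in> ?S'"
    then obtain a b where ab: "S = {b, a}" "(a, b) \<in> C" "fst b < fst a" by blast
    then have "bounding_rectangle {b, a} \<subseteq> P" "R {b, a}" by (simp_all add: C_iff br R')
    with ab show "S \<in> ?S" unfolding se_chains_def C_iff Q_def by blast
  qed
  moreover have "fst a < fst b \<or> fst b < fst a" if "(a, b) \<in> C" for a b
    using that by (cases "fst a" "fst b" rule: linorder_cases) (auto simp: C_def)
  then have "?N' \<union> ?S' = (\<lambda>(a, b). {a, b}) ` C" by fast
  ultimately have "?N \<union> ?S = (\<lambda>(a, b). {a, b}) ` C" by simp
  moreover have "inj_on (\<lambda>(a, b). {a, b}) C"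
    by (auto simp: inj_on_def C_def doubleton_eq_iff)
  ultimately have "card ?N + card ?S = card C"
    using card_Un_disjoint[OF fin disj] by (simp add: card_image)
  moreover have "row_pairs P f Q = (\<lambda>(a, b). (snd a, snd b)) ` C"
    unfolding row_pairs_def C_def by (force simp: image_iff)
  moreover have "inj_on (\<lambda>(a, b). (snd a, snd b)) C"
    using inj unfolding Q_def[symmetric] by (auto simp: inj_on_def C_def)
  ultimately show ?thesis by (simp add: card_image Q_def)
qed

lemma left_cell_pair: "fst a < fst b \<Longrightarrow> left_cell {a, b} = a"
  unfolding left_cell_def arg_min_def is_arg_min_def
  by (rule some_equality) (auto simp del: split_paired_Ex split_paired_All)

lemma right_cell_pair: "fst a < fst b \<Longrightarrow> right_cell {a, b} = b"
  unfolding right_cell_def arg_max_def is_arg_max_def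
  by (rule some_equality) (auto simp del: split_paired_Ex split_paired_All)

section \<open>The generating functions expressed by column orders\<close>

lemma sum_fillings_eq_order_gf:
  assumes "\<And>M. inj_on snd (ones P M) \<Longrightarrow> a M = card (row_pairs P f (ones P M))"
    and "\<And>M. inj_on snd (ones P M) \<Longrightarrow> b M = card (row_pairs P (\<lambda>v. - f v) (ones P M))"
  shows "(\<Sum>M\<in>fillings_with P e s. p ^ a M * q ^ b M) = order_gf P (placements P e s) f p q"
proof -
  have "inj_on snd (ones P M)" if "M \<in> fillings_with P e s" for M
    using bij_betwE[OF bij_betw_ones] that by (auto simp: placements_def)
  then show ?thesis
    unfolding order_gf_def sum.reindex_bij_betw[OF bij_betw_ones, symmetric]
    by (intro sum.cong) (simp_all add: assms)
qed

text \<open>With the columns ordered from right to left, the chains whose lower cell comes first are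
  exactly the SE chains.\<close>

lemma sum_se_ne_eq_order_gf:
  "(\<Sum>M\<in>fillings_with P e s. p ^ se P M * q ^ ne P M) =
    order_gf P (placements P e s) uminus p q"
proof (rule sum_fillings_eq_order_gf)
  fix M assume inj: "inj_on snd (ones P M)"
  show "se P M = card (row_pairs P uminus (ones P M))"
    using card_chains_eq_row_pairs[OF inj, of "\<lambda>_. False" uminus "\<lambda>_. True"] by (simp add: se_def)
  show "ne P M = card (row_pairs P (\<lambda>v. - (- v)) (ones P M))"
    using card_chains_eq_row_pairs[OF inj, of "\<lambda>_. True" id "\<lambda>_. False"]
    by (simp add: ne_def id_def)
qed

text \<open>The chain between the columns \<open>u < v\<close> is counted by \<open>\<gamma>(T)\<close> as NE or SE according to whether
  \<open>u\<close> belongs to \<open>T\<close>. So \<open>\<gamma>(T)\<close> counts pairs with respect to the order of the columns in which the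
  columns of \<open>T\<close> come first, increasingly, and the others afterwards, decreasingly. For \<open>\<delta>(T)\<close>
  the other columns come first, decreasingly.\<close>

definition fold_order :: "int \<Rightarrow> int set \<Rightarrow> int \<Rightarrow> int" where
  "fold_order K D v = (if v \<in> D then v - K else K - v)"

lemma G_left_eq_order_gf:
  assumes T: "T \<subseteq> {1..num_cols P}"
  obtains f where "inj_on f (fst ` P)"
    and "\<And>p q :: 'a::comm_semiring_1. G_left P e s T p q = order_gf P (placements P e s) f p q"
proof -
  \<comment> \<open>\<open>K\<close> exceeds all abscissae, so \<open>f\<close> is negative on the
    columns of \<open>T\<close> and positive on the others. Inserting 0 keeps \<open>Max\<close>
    defined when \<open>P\<close> is empty.\<close>
  define K where "K = Max (insert 0 (fst ` P)) + 1"
  define D where "D = fst ` cols P T"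
  define f where "f = fold_order K D"
  have D: "c \<in> cols P T \<longleftrightarrow> fst c \<in> D" if "c \<in> P" for c
    using cols_iff_column[OF that] by (simp add: D_def)
  have coD: "c \<in> cols P (co_cols P T) \<longleftrightarrow> fst c \<notin> D" if "c \<in> P" for c
    using cols_co_cols[OF that T] D[OF that] by simp
  have K: "fst c < K" if "c \<in> P" for c
  proof -
    have "fst c \<le> Max (insert 0 (fst ` P))" using that finite_moon by (intro Max_ge) auto
    then show ?thesis by (simp add: K_def)
  qed
  have "inj_on f (fst ` P)"
  proof (rule inj_onI)
    fix u v assume "u \<in> fst ` P" "v \<in> fst ` P" and eq: "f u = f v"
    then have "u < K" "v < K" using K by auto
    then show "u = v" using eq by (simp add: f_def fold_order_def split: if_splits)
  qed
  moreover have "G_left P e s T p q = order_gf P (placements P e s) f p q" for p q :: 'a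
    unfolding G_left_def
  proof (rule sum_fillings_eq_order_gf)
    have *: "left_cell {a, b} \<in> cols P T \<longleftrightarrow> f (fst a) < f (fst b)"
      "left_cell {a, b} \<in> cols P (co_cols P T) \<longleftrightarrow> f (fst b) < f (fst a)"
      if "a \<in> P" "b \<in> P" "fst a < fst b" for a b
      using that K[of a] K[of b]
      by (auto simp: left_cell_pair f_def fold_order_def D coD)
    have co: "co_cols P (co_cols P T) = T" using T by (auto simp: co_cols_def)
    fix M assume inj: "inj_on snd (ones P M)"
    show "gamma_stat P T M = card (row_pairs P f (ones P M))"
      unfolding gamma_stat_def by (rule card_chains_eq_row_pairs[OF inj]) (use * in auto)
    show "gamma_stat P (co_cols P T) M = card (row_pairs P (\<lambda>v. - f v) (ones P M))"
      unfolding gamma_stat_def co by (rule card_chains_eq_row_pairs[OF inj]) (use * in auto)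
  qed
  ultimately show ?thesis by (rule that)
qed

lemma G_right_eq_order_gf:
  assumes T: "T \<subseteq> {1..num_cols P}"
  obtains f where "inj_on f (fst ` P)"
    and "\<And>p q :: 'a::comm_semiring_1. G_right P e s T p q = order_gf P (placements P e s) f p q"
proof -
  \<comment> \<open>Now \<open>K\<close> lies below all abscissae, so the signs are reversed and the
    columns outside \<open>T\<close> come first.\<close>
  define K where "K = Min (insert 0 (fst ` P)) - 1"
  define D where "D = fst ` cols P T"
  define f where "f = fold_order K D"
  have D: "c \<in> cols P T \<longleftrightarrow> fst c \<in> D" if "c \<in> P" for c
    using cols_iff_column[OF that] by (simp add: D_def)
  have coD: "c \<in> cols P (co_cols P T) \<longleftrightarrow> fst c \<notin> D" if "c \<in> P" for c
    using cols_co_cols[OF that T] D[OF that] by simp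
  have K: "K < fst c" if "c \<in> P" for c
  proof -
    have "Min (insert 0 (fst ` P)) \<le> fst c" using that finite_moon by (intro Min_le) auto
    then show ?thesis by (simp add: K_def)
  qed
  have "inj_on f (fst ` P)"
  proof (rule inj_onI)
    fix u v assume "u \<in> fst ` P" "v \<in> fst ` P" and eq: "f u = f v"
    then have "K < u" "K < v" using K by auto
    then show "u = v" using eq by (simp add: f_def fold_order_def split: if_splits)
  qed
  moreover have "G_right P e s T p q = order_gf P (placements P e s) f p q" for p q :: 'a
    unfolding G_right_def
  proof (rule sum_fillings_eq_order_gf)
    have *: "right_cell {a, b} \<in> cols P T \<longleftrightarrow> f (fst a) < f (fst b)"
      "right_cell {a, b} \<in> cols P (co_cols P T) \<longleftrightarrow> f (fst b) < f (fst a)"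
      if "a \<in> P" "b \<in> P" "fst a < fst b" for a b
      using that K[of a] K[of b]
      by (auto simp: right_cell_pair f_def fold_order_def D coD)
    have co: "co_cols P (co_cols P T) = T" using T by (auto simp: co_cols_def)
    fix M assume inj: "inj_on snd (ones P M)"
    show "delta_stat P T M = card (row_pairs P f (ones P M))"
      unfolding delta_stat_def by (rule card_chains_eq_row_pairs[OF inj]) (use * in auto)
    show "delta_stat P (co_cols P T) M = card (row_pairs P (\<lambda>v. - f v) (ones P M))"
      unfolding delta_stat_def co by (rule card_chains_eq_row_pairs[OF inj]) (use * in auto)
  qed
  ultimately show ?thesis by (rule that)
qed

section \<open>Common value and symmetry\<close>

lemma order_gf_eq_sum_se_ne:
  assumes "inj_on f (fst ` P)"
  shows "order_gf P (placements P e s) f p q =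
    (\<Sum>M\<in>fillings_with P e s. p ^ se P M * q ^ ne P M)"
  unfolding sum_se_ne_eq_order_gf using assms by (intro order_gf_independent) simp_all

text \<open>Exchanging \<open>p\<close> and \<open>q\<close> amounts to reversing the column order,
  which does not change the sum.\<close>

lemma sum_se_ne_commute:
  fixes p q :: "'a::comm_semiring_1"
  shows "(\<Sum>M\<in>fillings_with P e s. p ^ se P M * q ^ ne P M) =
   (\<Sum>M\<in>fillings_with P e s. q ^ se P M * p ^ ne P M)"
proof -
  have "order_gf P (placements P e s) uminus p q = order_gf P (placements P e s) (\<lambda>v. v) q p"
    by (simp add: order_gf_def mult.commute)
  also have "\<dots> = order_gf P (placements P e s) uminus q p"
    by (rule order_gf_independent) simp_all
  finally show ?thesis unfolding sum_se_ne_eq_order_gf .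
qed

lemma G_left_eq_sum_se_ne:
  "T \<subseteq> {1..num_cols P} \<Longrightarrow>
    G_left P e s T p q = (\<Sum>M\<in>fillings_with P e s. p ^ se P M * q ^ ne P M)"
  by (metis G_left_eq_order_gf order_gf_eq_sum_se_ne)

lemma G_right_eq_sum_se_ne:
  "T \<subseteq> {1..num_cols P} \<Longrightarrow>
    G_right P e s T p q = (\<Sum>M\<in>fillings_with P e s. p ^ se P M * q ^ ne P M)"
  by (metis G_right_eq_order_gf order_gf_eq_sum_se_ne)

end

theorem theorem2p2:
  fixes P :: "cell set" and n m :: nat and e s :: "nat \<Rightarrow> nat"
    and p q :: "'a::comm_semiring_1"
  assumes "moon_polyomino P"
    and "n = num_rows P" and "m = num_cols P"
    and "\<And>i. i \<in> {1..n} \<Longrightarrow> e i \<in> {0, 1}"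
    and "(\<Sum>i=1..n. e i) = (\<Sum>j=1..m. s j)"
  shows "(\<forall>T T'. T \<subseteq> {1..m} \<and> T' \<subseteq> {1..m} \<longrightarrow> G_left P e s T p q = G_left P e s T' p q) \<and>
    (\<forall>T. T \<subseteq> {1..m} \<longrightarrow>
      G_left P e s T p q = G_left P e s {} p q \<and>
      G_left P e s {} p q = (\<Sum>M\<in>fillings_with P e s. p ^ se P M * q ^ ne P M) \<and>
      G_left P e s T p q = G_left P e s T q p) \<and>
    (\<forall>T T'. T \<subseteq> {1..m} \<and> T' \<subseteq> {1..m} \<longrightarrow> G_right P e s T p q = G_right P e s T' p q) \<and>
    (\<forall>T. T \<subseteq> {1..m} \<longrightarrow>
      G_right P e s T p q = G_right P e s {} p q \<and>
      G_right P e s {} p q = (\<Sum>M\<in>fillings_with P e s. p ^ se P M * q ^ ne P M) \<and>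
      G_right P e s T p q = G_right P e s T q p)"
  using G_left_eq_sum_se_ne[OF assms(1), of _ e s p q] G_left_eq_sum_se_ne[OF assms(1), of _ e s q p]
    G_right_eq_sum_se_ne[OF assms(1), of _ e s p q] G_right_eq_sum_se_ne[OF assms(1), of _ e s q p]
    sum_se_ne_commute[OF assms(1),
      where p = p and q = q and e = e and s = s]
  unfolding assms(3) by simp

end
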